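(* Let $K\subseteq L^0$ be a wedge and let $\Phi:[0,\infty)\to(-\infty,\infty]$ be a convex function which may take the value $\infty$ only at $0$. If $\Phi$ satisfies the growth condition and $M_\Phi\neq\emptyset$, then $$C_\Phi=R(\widehat M_\Phi)^\lhd=R(M_\Phi)^\lhd,$$ where the polar wedges are taken with respect to the bilinear system $(E_\Phi,F_\Phi)$. In particular, $C_\Phi$ is $\sigma(E_\Phi,F_\Phi)$-closed.
   Context: $(\Omega,\mathcal F,\mathbb P)$ is a probability space and $L^0=L^0(\Omega,\mathcal F,\mathbb P)$ is the vector lattice of real random variables modulo $\mathbb P$-a.s. equality, ordered $\mathbb P$-a.s. For a probability measure $\mathbb Q\ll\mathbb P$, $L^1(\mathbb Q)$ is regarded as the set of $X\in L^0$ with $\mathbb E_{\mathbb Q}|X|<\infty$, and $L^1_+(\mathbb Q)$ is its subset of non-negative elements. A wedge in a real vector space is a non-empty convex set $C$ with $\lambda C\subseteq C$ for all $\lambda\ge0$. $[S]$ is the linear span of $S$. $M_1=M_1(\mathbb P;K)$ is the set of all probability measures $\mathbb Q\ll\mathbb P$ such that $K\subseteq L^1(\mathbb Q)$ and $\mathbb E_{\mathbb Q}[X]\le0$ for all $X\in K$. $R(\mathbb Q):=\frac{d\mathbb Q}{d\mathbb P}\in L^1(\mathbb P)$. With $\Phi^+=\max\{\Phi,0\}$: $M_\Phi=\{\mathbb Q\in M_1:\mathbb E_{\mathbb P}[\Phi^+(\frac{d\mathbb Q}{d\mathbb P})]<\infty\}$ and $\widehat M_\Phi=\{\mathbb Q\in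 M_1:\mathbb E_{\mathbb P}[\Phi^+(\frac{d\mathbb Q}{d\mathbb P})1_{\{d\mathbb Q/d\mathbb P\ge1\}}]<\infty\}$. Growth condition on $\Phi$: for every interval $[\lambda_0,\lambda_1]\subseteq(0,\infty)$ there exist $\alpha>0$, $\beta>0$ such that $\Phi^+(\lambda y)\le\alpha\Phi^+(y)+\beta(y+1)$ for all $y>0$ and all $\lambda\in[\lambda_0,\lambda_1]$. $E_\Phi:=\bigcap_{\mathbb Q\in M_\Phi}L^1(\mathbb Q)$ and $F_\Phi:=[R(M_\Phi)]\subseteq L^1(\mathbb P)$, with bilinear form $\langle z,w\rangle:=\mathbb E_{\mathbb P}[zw]$ and associated weak topology $\sigma(E_\Phi,F_\Phi)$ (not necessarily Hausdorff). For non-empty $B\subseteq F_\Phi$, $B^\lhd=\{z\in E_\Phi:\langle z,w\rangle\le0\ \forall w\in B\}$. (Under the hypotheses, $R(\widehat M_\Phi)\subseteq F_\Phi$.) $C_\Phi:=\bigcap_{\mathbb Q\in M_\Phi}\overline{K-L^1_+(\mathbb Q)}^{L^1(\mathbb Q)}\subseteq E_\Phi$, where the closure consists of all $X\in L^1(\mathbb Q)$ for which there are $X_n\in K-L^1_+(\mathbb Q)$ with $\mathbb E_{\mathbb Q}|X-X_n|\to0$. *)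

theory Defs
  imports "HOL-Probability.Probability" "HOL-Library.Function_Algebras"
begin

text \<open>
  Function spaces carry the pointwise real vector space structure, so that the library notions
  \<^const>\<open>convex_cone\<close> (non-empty, convex, closed under multiplication by non-negative reals)
  and \<^const>\<open>span\<close> apply to sets of random variables.
\<close>

instantiation "fun" :: (type, real_vector) real_vector
begin

definition scaleR_fun :: "real \<Rightarrow> ('a \<Rightarrow> 'b) \<Rightarrow> 'a \<Rightarrow> 'b"
  where "scaleR_fun c f = (\<lambda>x. c *\<^sub>R f x)"

instance
  by standard
    (simp_all add: scaleR_fun_def plus_fun_def fun_eq_iff scaleR_add_right scaleR_add_left)

end

lemma scaleR_fun_apply [simp]: "(c *\<^sub>R f) x = c *\<^sub>R f x"
  by (simp add: scaleR_fun_def)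

text \<open>
  A subset of \<open>L\<^sup>0(P)\<close> is represented by the union of its equivalence classes, that is, by a set of
  measurable functions that is saturated with respect to \<open>P\<close>-a.s. equality. Equality and inclusion
  of such sets are equality and inclusion of the corresponding subsets of the quotient.
\<close>

definition L0_subset :: "'a measure \<Rightarrow> ('a \<Rightarrow> real) set \<Rightarrow> bool"
  where "L0_subset P S \<longleftrightarrow> S \<subseteq> borel_measurable P \<and>
    (\<forall>X\<in>S. \<forall>Y\<in>borel_measurable P. (AE \<omega> in P. X \<omega> = Y \<omega>) \<longrightarrow> Y \<in> S)"

definition L1 :: "'a measure \<Rightarrow> 'a measure \<Rightarrow> ('a \<Rightarrow> real) set"
  where "L1 P Q = {X \<in> borel_measurable P. integrable Q X}"

definition L1_plus :: "'a measure \<Rightarrow> 'a measure \<Rightarrow> ('a \<Rightarrow> real) set"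
  where "L1_plus P Q = {X \<in> L1 P Q. AE \<omega> in P. 0 \<le> X \<omega>}"

definition M1 :: "'a measure \<Rightarrow> ('a \<Rightarrow> real) set \<Rightarrow> 'a measure set"
  where "M1 P K = {Q. prob_space Q \<and> sets Q = sets P \<and> absolutely_continuous P Q \<and>
    K \<subseteq> L1 P Q \<and> (\<forall>X\<in>K. (LINT \<omega>|Q. X \<omega>) \<le> 0)}"

definition density_rv :: "'a measure \<Rightarrow> 'a measure \<Rightarrow> 'a \<Rightarrow> real"
  where "density_rv P Q \<omega> = enn2real (RN_deriv P Q \<omega>)"

text \<open>
  The image of a set of measures under \<open>R(Q) = dQ/dP\<close>, as a subset of \<open>L\<^sup>0(P)\<close>: it contains
  all versions of the densities.
\<close>

definition R_image :: "'a measure \<Rightarrow> 'a measure set \<Rightarrow> ('a \<Rightarrow> real) set"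
  where "R_image P M =
    {w \<in> borel_measurable P. \<exists>Q\<in>M. AE \<omega> in P. w \<omega> = density_rv P Q \<omega>}"

text \<open>
  A function \<open>[0,\<infinity>) \<rightarrow> (-\<infinity>,\<infinity>]\<close> is represented by a function on \<open>real\<close> of which only the values
  on \<open>[0,\<infinity>)\<close> are ever used.
\<close>

definition proper_convex_halfline :: "(real \<Rightarrow> ereal) \<Rightarrow> bool"
  where "proper_convex_halfline \<Phi> \<longleftrightarrow>
    (\<forall>x\<ge>0. \<Phi> x \<noteq> -\<infinity>) \<and> (\<forall>x>0. \<Phi> x \<noteq> \<infinity>) \<and>
    (\<forall>x\<ge>0. \<forall>y\<ge>0. \<forall>t. 0 < t \<and> t < 1 \<longrightarrow>
       \<Phi> ((1 - t) * x + t * y) \<le> ereal (1 - t) * \<Phi> x + ereal t * \<Phi> y)"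

definition pos_part :: "(real \<Rightarrow> ereal) \<Rightarrow> real \<Rightarrow> ereal"
  where "pos_part \<Phi> y = max (\<Phi> y) 0"

definition growth_condition :: "(real \<Rightarrow> ereal) \<Rightarrow> bool"
  where "growth_condition \<Phi> \<longleftrightarrow>
    (\<forall>l0 l1. 0 < l0 \<and> l0 \<le> l1 \<longrightarrow>
      (\<exists>\<alpha>>0. \<exists>\<beta>>0. \<forall>y>0. \<forall>l\<in>{l0..l1}.
        pos_part \<Phi> (l * y) \<le> ereal \<alpha> * pos_part \<Phi> y + ereal (\<beta> * (y + 1))))"

definition M_Phi :: "'a measure \<Rightarrow> ('a \<Rightarrow> real) set \<Rightarrow> (real \<Rightarrow> ereal) \<Rightarrow> 'a measure set"
  where "M_Phi P K \<Phi> =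
    {Q \<in> M1 P K. (\<integral>\<^sup>+ \<omega>. e2ennreal (pos_part \<Phi> (density_rv P Q \<omega>)) \<partial>P) < \<infinity>}"

definition M_Phi_hat :: "'a measure \<Rightarrow> ('a \<Rightarrow> real) set \<Rightarrow> (real \<Rightarrow> ereal) \<Rightarrow> 'a measure set"
  where "M_Phi_hat P K \<Phi> =
    {Q \<in> M1 P K. (\<integral>\<^sup>+ \<omega>. e2ennreal (pos_part \<Phi> (density_rv P Q \<omega>)) *
                    indicator {\<omega>. 1 \<le> density_rv P Q \<omega>} \<omega> \<partial>P) < \<infinity>}"

definition E_Phi :: "'a measure \<Rightarrow> ('a \<Rightarrow> real) set \<Rightarrow> (real \<Rightarrow> ereal) \<Rightarrow> ('a \<Rightarrow> real) set"
  where "E_Phi P K \<Phi> = (\<Inter>Q\<in>M_Phi P K \<Phi>. L1 P Q)"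

definition F_Phi :: "'a measure \<Rightarrow> ('a \<Rightarrow> real) set \<Rightarrow> (real \<Rightarrow> ereal) \<Rightarrow> ('a \<Rightarrow> real) set"
  where "F_Phi P K \<Phi> = span (R_image P (M_Phi P K \<Phi>))"

definition pairing :: "'a measure \<Rightarrow> ('a \<Rightarrow> real) \<Rightarrow> ('a \<Rightarrow> real) \<Rightarrow> real"
  where "pairing P z w = (LINT \<omega>|P. z \<omega> * w \<omega>)"

text \<open>
  The coarsest topology on \<open>E\<close> for which all maps \<open>z \<mapsto> \<langle>z, w\<rangle>\<close> with \<open>w \<in> F\<close> are continuous.
\<close>

definition weak_topology ::
    "'a measure \<Rightarrow> ('a \<Rightarrow> real) set \<Rightarrow> ('a \<Rightarrow> real) set \<Rightarrow> ('a \<Rightarrow> real) topology"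
  where "weak_topology P E F =
    topology_generated_by {{z \<in> E. pairing P z w \<in> U} | w U. w \<in> F \<and> open U}"

definition polar :: "'a measure \<Rightarrow> ('a \<Rightarrow> real) set \<Rightarrow> ('a \<Rightarrow> real) set \<Rightarrow> ('a \<Rightarrow> real) set"
  where "polar P E B = {z \<in> E. \<forall>w\<in>B. pairing P z w \<le> 0}"

definition L1_closure :: "'a measure \<Rightarrow> 'a measure \<Rightarrow> ('a \<Rightarrow> real) set \<Rightarrow> ('a \<Rightarrow> real) set"
  where "L1_closure P Q S = {X \<in> L1 P Q. \<exists>Xs :: nat \<Rightarrow> 'a \<Rightarrow> real. (\<forall>n. Xs n \<in> S) \<and>
    (\<lambda>n. \<integral>\<^sup>+ \<omega>. ennreal \<bar>X \<omega> - Xs n \<omega>\<bar> \<partial>Q) \<longlonglongrightarrow> 0}"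

definition C_Phi :: "'a measure \<Rightarrow> ('a \<Rightarrow> real) set \<Rightarrow> (real \<Rightarrow> ereal) \<Rightarrow> ('a \<Rightarrow> real) set"
  where "C_Phi P K \<Phi> =
    (\<Inter>Q\<in>M_Phi P K \<Phi>. L1_closure P Q {X - Y | X Y. X \<in> K \<and> Y \<in> L1_plus P Q})"

end

theory Submission
  imports Defs
begin

text \<open>
  If \<open>z\<close> is non-positive under every measure of \<open>M_Phi\<close> but lies outside the \<open>L1(Q)\<close>-closure of
  \<open>K - L1_plus\<close> for some such \<open>Q\<close>, Hahn-Banach applied to the distance from this cone yields a
  positive functional, that is, a density \<open>0 \<le> g \<le> 1\<close> with \<open>E_Q[g f] \<le> 0\<close> on the cone and
  \<open>E_Q[g z] > 0\<close>. For small \<open>e > 0\<close> the function \<open>g + e\<close> still separates and is bounded away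
  from 0 and infinity, so by the growth condition its normalization is the \<open>Q\<close>-density of a
  measure in \<open>M_Phi\<close>, a contradiction. A measure in \<open>M_Phi_hat\<close> is reached as the limit
  \<open>t \<rightarrow> 0\<close> of its mixtures \<open>(1 - t) Q + t Q0\<close> with some \<open>Q0\<close> in \<open>M_Phi\<close>, which all belong to \<open>M_Phi\<close>.
\<close>

subsection \<open>Separation from a convex cone in \<open>L1\<close>\<close>

definition sublinear :: "('v::real_vector \<Rightarrow> real) \<Rightarrow> bool"
  where "sublinear p \<longleftrightarrow> (\<forall>x y. p (x + y) \<le> p x + p y) \<and> (\<forall>c\<ge>0. \<forall>x. p (c *\<^sub>R x) = c * p x)"

lemma sublinear_add: "sublinear p \<Longrightarrow> p (x + y) \<le> p x + p y"
  by (simp add: sublinear_def)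

lemma sublinear_scale: "sublinear p \<Longrightarrow> 0 \<le> c \<Longrightarrow> p (c *\<^sub>R x) = c * p x"
  by (simp add: sublinear_def)

lemma sublinear_zero: "sublinear p \<Longrightarrow> p 0 = 0"
  using sublinear_scale[of p 0 0] by simp

lemma sublinear_minus_le: "sublinear p \<Longrightarrow> - p (- x) \<le> p x"
  using sublinear_add[of p x "- x"] sublinear_zero[of p] by simp

text \<open>Serves three infima below: over translates along a direction, over a chain of
  functionals, and over distances to the points of a cone. An infimum inherits subadditivity as soon
  as any two indices are jointly dominated by a third one. Since \<open>INF\<close> is taken in the
  reals, boundedness below has to accompany every use.\<close>

lemma sublinear_INF:
  fixes f :: "'i \<Rightarrow> 'v::real_vector \<Rightarrow> real"
  assumes ne: "I \<noteq> {}"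
    and bdd: "\<And>x. bdd_below ((\<lambda>i. f i x) ` I)"
    and add: "\<And>i j x y. i \<in> I \<Longrightarrow> j \<in> I \<Longrightarrow> \<exists>k\<in>I. f k (x + y) \<le> f i x + f j y"
    and scale: "\<And>i c x. i \<in> I \<Longrightarrow> 0 < c \<Longrightarrow> \<exists>k\<in>I. f k (c *\<^sub>R x) \<le> c * f i x"
    and zero: "(INF i\<in>I. f i 0) = 0"
  shows "sublinear (\<lambda>x. INF i\<in>I. f i x)"
proof -
  let ?q = "\<lambda>x. INF i\<in>I. f i x"
  have low: "?q x \<le> f i x" if "i \<in> I" for i x
    by (rule cINF_lower[OF bdd that])
  have sub: "?q (x + y) \<le> ?q x + ?q y" for x y
  proof -
    have "?q (x + y) - f j y \<le> ?q x" if j: "j \<in> I" for j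
    proof (rule cINF_greatest[OF ne])
      fix i assume i: "i \<in> I"
      obtain k where "k \<in> I" "f k (x + y) \<le> f i x + f j y" using add[OF i j] by blast
      with low[of k "x + y"] show "?q (x + y) - f j y \<le> f i x" by linarith
    qed
    then have "?q (x + y) - ?q x \<le> ?q y"
      by (intro cINF_greatest[OF ne]) (simp add: algebra_simps)
    then show ?thesis by linarith
  qed
  have le: "?q (c *\<^sub>R x) \<le> c * ?q x" if c: "0 < c" for c x
  proof -
    have "?q (c *\<^sub>R x) / c \<le> ?q x"
    proof (rule cINF_greatest[OF ne])
      fix i assume i: "i \<in> I"
      obtain k where "k \<in> I" "f k (c *\<^sub>R x) \<le> c * f i x" using scale[OF i c] by blast
      with low[of k "c *\<^sub>R x"] have "?q (c *\<^sub>R x) \<le> c * f i x" by linarith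
      then show "?q (c *\<^sub>R x) / c \<le> f i x" using c by (simp add: field_simps)
    qed
    then show ?thesis using c by (simp add: field_simps)
  qed
  have "?q (c *\<^sub>R x) = c * ?q x" if c: "0 \<le> c" for c x
  proof (cases "c = 0")
    case False
    with c have pos: "0 < c" by simp
    \<comment> \<open>The hypotheses give only one inequality for scaling; applying it with the
      factor \<open>1 / c\<close> gives the reverse one.\<close>
    have "?q ((1 / c) *\<^sub>R (c *\<^sub>R x)) \<le> (1 / c) * ?q (c *\<^sub>R x)"
      by (rule le) (use pos in simp)
    then have "c * ?q x \<le> ?q (c *\<^sub>R x)" using pos by (simp add: field_simps)
    with le[OF pos, of x] show ?thesis by linarith
  qed (use zero in simp)
  with sub show ?thesis unfolding sublinear_def by blast
qed

text \<open>Pushes \<open>p\<close> down until it is additive along \<open>v\<close>: take the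
  infimum over \<open>t \<ge> 0\<close> of \<open>p (x + t v) - t * p v\<close>. The term
  \<open>t = 0\<close> gives \<open>q \<le> p\<close>, and \<open>t = 1\<close> at
  \<open>- v\<close> gives the last claim. A linear functional below \<open>q\<close> therefore
  attains \<open>p\<close> at \<open>v\<close>.\<close>

lemma sublinear_directional:
  assumes p: "sublinear p"
  obtains q where "sublinear q" "\<And>x. q x \<le> p x" "q (- v) \<le> - p v"
proof -
  let ?f = "\<lambda>t x. p (x + t *\<^sub>R v) - t * p v"
  let ?q = "\<lambda>x. INF t\<in>{0..}. ?f t x"
  have lb: "- p (- x) \<le> ?f t x" if "0 \<le> t" for t x
    using sublinear_add[OF p, of "x + t *\<^sub>R v" "- x"] sublinear_scale[OF p that, of v] by simp
  have bdd: "bdd_below ((\<lambda>t. ?f t x) ` {0..})" for x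
    using lb by (intro bdd_belowI[of _ "- p (- x)"]) auto
  have "sublinear ?q"
  proof (rule sublinear_INF[OF _ bdd])
    fix s t :: real and x y assume "s \<in> {0..}" "t \<in> {0..}"
    then show "\<exists>k\<in>{0..}. ?f k (x + y) \<le> ?f s x + ?f t y"
      using sublinear_add[OF p, of "x + s *\<^sub>R v" "y + t *\<^sub>R v"]
      by (intro bexI[of _ "s + t"]) (auto simp: algebra_simps)
  next
    fix s c :: real and x assume "s \<in> {0..}" "0 < c"
    then show "\<exists>k\<in>{0..}. ?f k (c *\<^sub>R x) \<le> c * ?f s x"
      using sublinear_scale[OF p, of c "x + s *\<^sub>R v"]
      by (intro bexI[of _ "c * s"]) (auto simp: algebra_simps)
  next
    have "(\<lambda>t. ?f t 0) ` {0..} = {0}"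
      using sublinear_scale[OF p, of _ v] by (auto simp: image_iff intro!: exI[of _ 0])
    then show "(INF t\<in>{0..}. ?f t 0) = 0" by simp
  qed auto
  moreover have "?q x \<le> p x" for x
    using cINF_lower[OF bdd, of 0 x] by simp
  moreover have "?q (- v) \<le> - p v"
    using cINF_lower[OF bdd, of 1 "- v"] sublinear_zero[OF p] by simp
  ultimately show ?thesis using that by blast
qed

text \<open>Minimal sublinear functionals are linear, so Zorn's lemma on the functionals below \<open>p\<close>
  replaces the usual extension from subspaces.\<close>

lemma sublinear_minimal:
  fixes p :: "'v::real_vector \<Rightarrow> real"
  assumes p: "sublinear p"
  obtains m where "sublinear m" "m \<le> p" "\<And>q. sublinear q \<Longrightarrow> q \<le> m \<Longrightarrow> q = m"
proof -
  let ?A = "{q. sublinear q \<and> q \<le> p}"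
  let ?R = "relation_of (\<lambda>x y. y \<le> x) ?A"
  have "\<exists>m\<in>?A. \<forall>a\<in>?A. a \<le> m \<longrightarrow> a = m"
  proof (rule predicate_Zorn)
    show "partial_order_on ?A ?R"
      by (rule partial_order_on_relation_ofI) (auto intro: order.trans antisym)
  next
    fix C assume C: "C \<in> Chains ?R"
    then have CA: "q \<in> ?A" if "q \<in> C" for q
      using that unfolding Chains_def relation_of_def by auto
    have CC: "q \<le> r \<or> r \<le> q" if "q \<in> C" "r \<in> C" for q r
      using C that unfolding Chains_def relation_of_def by auto
    show "\<exists>u\<in>?A. \<forall>a\<in>C. u \<le> a"
    proof (cases "C = {}")
      case True
      then show ?thesis using p by auto
    next
      case False
      \<comment> \<open>The bound does not depend on the member of the chain, because
        \<open>q x \<ge> - q (- x) \<ge> - p (- x)\<close>; so the pointwise infimum of the chain is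
        finite.\<close>
      have lb: "- p (- x) \<le> q x" if "q \<in> C" for q x
        using sublinear_minus_le[of q x] CA[OF that] by (auto simp: le_fun_def) (metis dual_order.trans neg_le_iff_le)
      have bdd: "bdd_below ((\<lambda>q. q x) ` C)" for x
        using lb by (intro bdd_belowI[of _ "- p (- x)"]) auto
      have "sublinear (\<lambda>x. INF q\<in>C. q x)"
      proof (rule sublinear_INF[OF False bdd])
        fix q r x y assume qr: "q \<in> C" "r \<in> C"
        \<comment> \<open>Of two comparable functionals the smaller one can be used for both
          summands.\<close>
        from CC[OF qr] show "\<exists>k\<in>C. k (x + y) \<le> q x + r y"
        proof
          assume "q \<le> r"
          then have "q (x + y) \<le> q x + r y"
            using sublinear_add[of q x y] CA[OF qr(1)] le_funD[of q r y] by force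
          then show ?thesis using qr by blast
        next
          assume "r \<le> q"
          then have "r (x + y) \<le> q x + r y"
            using sublinear_add[of r x y] CA[OF qr(2)] le_funD[of r q x] by force
          then show ?thesis using qr by blast
        qed
      next
        fix q x and c :: real assume "q \<in> C" "0 < c"
        then show "\<exists>k\<in>C. k (c *\<^sub>R x) \<le> c * q x"
          using sublinear_scale[of q c x] CA by (intro bexI[of _ q]) auto
      next
        have "(\<lambda>q. q 0) ` C = {0}" using False CA sublinear_zero by (force simp: image_iff)
        then show "(INF q\<in>C. q 0) = 0" by simp
      qed
      moreover have "(\<lambda>x. INF q\<in>C. q x) \<le> a" if "a \<in> C" for a
        by (rule le_funI) (rule cINF_lower[OF bdd that])
      moreover obtain a where "a \<in> C" using False by blast
      ultimately show ?thesis using CA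
        by (intro bexI[of _ "\<lambda>x. INF q\<in>C. q x"]) (auto intro: order.trans)
    qed
  qed
  then obtain m where "m \<in> ?A" "\<forall>a\<in>?A. a \<le> m \<longrightarrow> a = m" by blast
  then show ?thesis by (intro that[of m]) (auto intro: order.trans)
qed

text \<open>Minimality is applied below the directional modification \<open>q\<close> and not below
  \<open>p\<close> itself: this forces the linear functional to touch \<open>p\<close> at the
  prescribed vector \<open>v\<close>.\<close>

lemma hahn_banach_sublinear:
  fixes p :: "'v::real_vector \<Rightarrow> real"
  assumes p: "sublinear p"
  obtains l where "linear l" "\<And>x. l x \<le> p x" "l v = p v"
proof -
  obtain q where q: "sublinear q" "\<And>x. q x \<le> p x" "q (- v) \<le> - p v"
    using sublinear_directional[OF p] by blast
  obtain m where m: "sublinear m" "m \<le> q" "\<And>q. sublinear q \<Longrightarrow> q \<le> m \<Longrightarrow> q = m"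
    using sublinear_minimal[OF q(1)] by blast
  have neg: "m (- x) = - m x" for x
  proof -
    obtain r where r: "sublinear r" "\<And>y. r y \<le> m y" "r (- x) \<le> - m x"
      using sublinear_directional[OF m(1)] by blast
    \<comment> \<open>Modifying \<open>m\<close> in the direction \<open>x\<close> cannot lower it,
      so \<open>m\<close> satisfies \<open>m (- x) \<le> - m x\<close> and is odd. Subadditivity at
      the negated vectors then yields additivity.\<close>
    have "r = m" using r by (intro m(3)) (auto simp: le_fun_def)
    then show ?thesis using r(3) sublinear_minus_le[OF m(1), of x] by simp
  qed
  have add: "m (x + y) = m x + m y" for x y
    using sublinear_add[OF m(1), of x y] sublinear_add[OF m(1), of "- x" "- y"] neg[of "x + y"]
    by (simp add: neg)
  have scale: "m (c *\<^sub>R x) = c *\<^sub>R m x" for c x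
  proof (cases "0 \<le> c")
    case False
    then show ?thesis
      using sublinear_scale[OF m(1), of "- c" x] neg[of "c *\<^sub>R x"] by simp
  qed (simp add: sublinear_scale[OF m(1)])
  have le: "m x \<le> p x" for x
    using m(2) q(2)[of x] by (metis le_funD order.trans)
  have "m v \<ge> p v"
    using q(3) le_funD[OF m(2), of "- v"] neg[of v] by linarith
  with le[of v] have "m v = p v" by linarith
  with that[of m] le show ?thesis by (auto intro: linearI add scale)
qed

section \<open>Dominated positive functionals on \<open>L1\<close> and separating densities\<close>

text \<open>A concrete form of the duality between \<open>L1\<close> and bounded functions: the
  values of \<open>l\<close> on indicators form a measure below \<open>Q\<close>, its Radon-Nikodym
  derivative is the density, and domination by the norm carries the formula from indicators to all
  integrable functions.\<close>

lemma positive_functional_density: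
  fixes l :: "('a \<Rightarrow> real) \<Rightarrow> real"
  assumes "finite_measure Q"
    and lin: "linear l"
    and pos: "\<And>f. integrable Q f \<Longrightarrow> (\<And>x. 0 \<le> f x) \<Longrightarrow> 0 \<le> l f"
    and bound: "\<And>f. integrable Q f \<Longrightarrow> l f \<le> (LINT x|Q. \<bar>f x\<bar>)"
  obtains g where "g \<in> borel_measurable Q" "\<And>x. 0 \<le> g x" "\<And>x. g x \<le> 1"
    "\<And>f. integrable Q f \<Longrightarrow> l f = (LINT x|Q. g x * f x)"
proof -
  interpret finite_measure Q by fact
  define \<nu> where "\<nu> A = ennreal (l (indicator A))" for A
  define N where "N = measure_of (space Q) (sets Q) \<nu>"
  have int_ind: "integrable Q (indicator A :: 'a \<Rightarrow> real)" if "A \<in> sets Q" for A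
    using that by (simp add: less_top[symmetric])
  have l_pos: "0 \<le> l (indicator A)" if "A \<in> sets Q" for A
    using pos int_ind[OF that] by simp
  have l_le: "l (indicator A) \<le> measure Q A" if "A \<in> sets Q" for A
    using bound[OF int_ind[OF that]] that by simp
  have add: "additive (sets Q) \<nu>"
    unfolding additive_def
  proof (intro ballI impI)
    fix A B assume AB: "A \<in> sets Q" "B \<in> sets Q" "A \<inter> B = {}"
    have "(indicator (A \<union> B) :: 'a \<Rightarrow> real) = indicator A + indicator B"
      using AB(3) by (auto simp: fun_eq_iff split: split_indicator)
    then show "\<nu> (A \<union> B) = \<nu> A + \<nu> B"
      using l_pos AB by (simp add: \<nu>_def linear_add[OF lin] ennreal_plus)
  qed
  have posi: "positive (sets Q) \<nu>"
  proof -
    have "(indicator {} :: 'a \<Rightarrow> real) = 0" by (simp add: fun_eq_iff)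
    then show ?thesis unfolding positive_def \<nu>_def by (simp add: linear_0[OF lin])
  qed
  \<comment> \<open>For a finitely additive finite set function continuity at the empty set
    suffices, and there \<open>l\<close> is squeezed between 0 and the finite measure
    \<open>Q\<close>.\<close>
  have cadd: "countably_additive (sets Q) \<nu>"
  proof (rule sets.empty_continuous_imp_countably_additive[OF posi add])
    fix A :: "nat \<Rightarrow> 'a set"
    assume A: "range A \<subseteq> sets Q" "decseq A" "(\<Inter>i. A i) = {}"
    have "(\<lambda>i. measure Q (A i)) \<longlonglongrightarrow> 0"
      using finite_Lim_measure_decseq[OF A(1,2)] A(3) by simp
    then have "(\<lambda>i. l (indicator (A i))) \<longlonglongrightarrow> 0"
      by (rule tendsto_sandwich[OF _ _ tendsto_const, rotated 2])
        (use l_pos l_le A(1) in \<open>auto intro!: always_eventually\<close>)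
    then show "(\<lambda>i. \<nu> (A i)) \<longlonglongrightarrow> 0"
      unfolding \<nu>_def using tendsto_ennrealI by fastforce
  qed (simp add: \<nu>_def)
  have emN: "emeasure N A = \<nu> A" if "A \<in> sets Q" for A
    unfolding N_def by (rule emeasure_measure_of_sigma[OF _ posi cadd that]) (rule sets.sigma_algebra_axioms)
  have setsN: "sets N = sets Q" by (simp add: N_def)
  have "absolutely_continuous Q N"
    unfolding absolutely_continuous_def null_sets_def
  proof safe
    fix A assume "A \<in> sets Q" "emeasure Q A = 0"
    then show "emeasure N A = 0"
      using l_le[of A] by (simp add: emN \<nu>_def measure_def ennreal_neg)
  qed (simp add: setsN)
  from Radon_Nikodym[OF this setsN] obtain h where
    h[measurable]: "h \<in> borel_measurable Q" and dens: "density Q h = N" by blast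
  have hA: "(\<integral>\<^sup>+x\<in>A. h x \<partial>Q) = ennreal (l (indicator A))" if "A \<in> sets Q" for A
    using emN[OF that] that by (simp add: dens[symmetric] emeasure_density \<nu>_def)
  have "AE x in Q. h x \<le> 1"
  proof -
    \<comment> \<open>On the set where \<open>h\<close> exceeds 1, splitting \<open>h\<close> into 1
      and the excess gives \<open>Q ?A\<close> plus the integral of the excess equal to
      \<open>l (indicator ?A)\<close>, which is at most \<open>Q ?A\<close>. Cancelling the finite
      \<open>Q ?A\<close> shows that the excess is null.\<close>
    let ?A = "{x \<in> space Q. 1 < h x}"
    have "(\<integral>\<^sup>+x. 1 * indicator ?A x + (h x - 1) * indicator ?A x \<partial>Q) = (\<integral>\<^sup>+x\<in>?A. h x \<partial>Q)"
      by (intro nn_integral_cong) (auto split: split_indicator simp: add_diff_inverse_ennreal)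
    then have "emeasure Q ?A + (\<integral>\<^sup>+x\<in>?A. (h x - 1) \<partial>Q) = ennreal (l (indicator ?A))"
      by (subst (asm) nn_integral_add) (simp_all add: hA)
    also have "\<dots> \<le> emeasure Q ?A"
      using l_le[of ?A] by (simp add: emeasure_eq_measure ennreal_leI)
    finally have "(\<integral>\<^sup>+x\<in>?A. (h x - 1) \<partial>Q) = 0"
      using ennreal_add_left_cancel_le[of "emeasure Q ?A" _ 0] emeasure_finite[of ?A]
      by (simp only: add_0_right) (simp only: infinity_ennreal_def le_zero_eq simp_thms)
    then have "AE x in Q. (h x - 1) * indicator ?A x = 0"
      by (subst (asm) nn_integral_0_iff_AE) auto
    with AE_space show ?thesis
      by eventually_elim (auto split: split_indicator_asm dest: ennreal_minus_eq_0 simp: not_less)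
  qed
  \<comment> \<open>The truncation alters \<open>h\<close> only on a null set and makes the bounds 0
    and 1 hold at every point.\<close>
  define g where "g x = min 1 (enn2real (h x))" for x
  have g_meas[measurable]: "g \<in> borel_measurable Q" unfolding g_def by measurable
  have g_nn: "0 \<le> g x" and g_le: "g x \<le> 1" for x by (auto simp: g_def)
  have hg: "AE x in Q. h x = ennreal (g x)"
    using \<open>AE x in Q. h x \<le> 1\<close>
  proof eventually_elim
    case (elim x)
    then show ?case by (cases "h x") (auto simp: g_def min_def top_unique)
  qed
  have int_g: "integrable Q (\<lambda>x. g x * f x)" if "integrable Q f" for f
    by (rule Bochner_Integration.integrable_bound[OF that])
      (use that in \<open>auto simp: abs_mult g_nn g_le intro!: mult_left_le_one_le\<close>)
  have "l f = (LINT x|Q. g x * f x)" if "integrable Q f" for f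
    using that
  proof (induct rule: integrable_induct)
    case (base A c)
    have "ennreal (l (indicator A)) = (\<integral>\<^sup>+x. ennreal (g x * indicator A x) \<partial>Q)"
      unfolding hA[OF base(1), symmetric] using hg
      by (intro nn_integral_cong_AE) (auto simp: ennreal_mult' split: split_indicator)
    also have "\<dots> = ennreal (LINT x|Q. g x * indicator A x)"
      using int_g[OF int_ind[OF base(1)]] g_nn by (intro nn_integral_eq_integral) auto
    finally have "l (indicator A) = (LINT x|Q. g x * indicator A x)"
      using l_pos[OF base(1)] g_nn by (subst (asm) ennreal_inj) (auto intro!: integral_nonneg_AE)
    moreover have "(\<lambda>x. indicator A x *\<^sub>R c) = c *\<^sub>R (indicator A :: 'a \<Rightarrow> real)"
      by (auto simp: fun_eq_iff)
    ultimately show ?case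
      by (simp add: linear_scale[OF lin] flip: mult.assoc)
  next
    case (add f1 f2)
    then show ?case
      using linear_add[OF lin, of f1 f2] int_g by (simp add: plus_fun_def distrib_left)
  next
    case (lim f s)
    have [measurable]: "f \<in> borel_measurable Q" "\<And>i. s i \<in> borel_measurable Q"
      using lim(1,5) by auto
    \<comment> \<open>The approximants satisfy
      \<open>\<bar>s i x\<bar> \<le> 2 * \<bar>f x\<bar>\<close>, hence the majorant with factor 3.
      Applying \<open>bound\<close> to both signs of the difference turns this \<open>L1\<close>
      convergence into convergence of \<open>l (s i)\<close>.\<close>
    have "(\<lambda>i. LINT x|Q. \<bar>f x - s i x\<bar>) \<longlonglongrightarrow> (LINT x|Q. 0)"
    proof (rule integral_dominated_convergence[where w="\<lambda>x. 3 * \<bar>f x\<bar>"])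
      show "AE x in Q. (\<lambda>i. \<bar>f x - s i x\<bar>) \<longlonglongrightarrow> 0"
      proof (rule AE_I2)
        fix x assume "x \<in> space Q"
        from tendsto_rabs[OF tendsto_diff[OF tendsto_const lim(3)[OF this]], of "f x"]
        show "(\<lambda>i. \<bar>f x - s i x\<bar>) \<longlonglongrightarrow> 0" by simp
      qed
      show "AE x in Q. norm \<bar>f x - s i x\<bar> \<le> 3 * \<bar>f x\<bar>" for i
      proof (rule AE_I2)
        fix x assume "x \<in> space Q"
        from lim(4)[OF this, of i] show "norm \<bar>f x - s i x\<bar> \<le> 3 * \<bar>f x\<bar>" by simp
      qed
    qed (use lim(5) in auto)
    moreover have "\<bar>l (s i) - l f\<bar> \<le> (LINT x|Q. \<bar>f x - s i x\<bar>)" for i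
    proof -
      have "integrable Q (f - s i)" "integrable Q (s i - f)"
        using lim(1)[of i] lim(5) by (simp_all add: fun_diff_def)
      then have "l (f - s i) \<le> (LINT x|Q. \<bar>f x - s i x\<bar>)"
        "l (s i - f) \<le> (LINT x|Q. \<bar>f x - s i x\<bar>)"
        using bound[of "f - s i"] bound[of "s i - f"] by (simp_all add: abs_minus_commute)
      then show ?thesis by (simp add: linear_diff[OF lin])
    qed
    ultimately have "(\<lambda>i. l (s i) - l f) \<longlonglongrightarrow> 0"
      by - (rule Lim_null_comparison[OF always_eventually], simp_all)
    then have "(\<lambda>i. l (s i)) \<longlonglongrightarrow> l f" by (rule LIM_zero_cancel)
    moreover have "(\<lambda>i. LINT x|Q. g x * s i x) \<longlonglongrightarrow> (LINT x|Q. g x * f x)"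
    proof (rule integral_dominated_convergence[where w="\<lambda>x. 2 * \<bar>f x\<bar>"])
      show "AE x in Q. (\<lambda>i. g x * s i x) \<longlonglongrightarrow> g x * f x"
        using lim(3) by (auto intro!: AE_I2 tendsto_mult)
      show "AE x in Q. norm (g x * s i x) \<le> 2 * \<bar>f x\<bar>" for i
      proof (rule AE_I2)
        fix x assume "x \<in> space Q"
        have "\<bar>g x * s i x\<bar> \<le> \<bar>s i x\<bar>"
          by (simp add: abs_mult g_nn g_le mult_left_le_one_le)
        with lim(4)[OF \<open>x \<in> space Q\<close>, of i] show "norm (g x * s i x) \<le> 2 * \<bar>f x\<bar>" by simp
      qed
    qed (use lim(5) in auto)
    ultimately show ?case unfolding lim(2) by (rule LIMSEQ_unique)
  qed
  then show ?thesis using that[of g] g_meas g_nn g_le by blast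
qed

text \<open>The distance from a convex cone is sublinear. A linear functional below it is
  non-positive on \<open>C\<close>, where the distance vanishes, and it can be chosen to equal the
  distance at \<open>X\<close>. Since \<open>C\<close> contains the negatives of non-negative
  integrable functions, the functional is positive and so has a density.\<close>

lemma L1_separation:
  fixes X :: "'a \<Rightarrow> real"
  assumes Q: "finite_measure Q" and C: "convex_cone C"
    and C_int: "\<And>f. f \<in> C \<Longrightarrow> integrable Q f"
    and C_neg: "\<And>f. integrable Q f \<Longrightarrow> (\<And>x. 0 \<le> f x) \<Longrightarrow> - f \<in> C"
    and X: "integrable Q X" and d: "0 < d"
    and dist: "\<And>f. f \<in> C \<Longrightarrow> d \<le> (LINT x|Q. \<bar>X x - f x\<bar>)"
  obtains g where "g \<in> borel_measurable Q" "\<And>x. 0 \<le> g x" "\<And>x. g x \<le> 1"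
    "\<And>f. f \<in> C \<Longrightarrow> (LINT x|Q. g x * f x) \<le> 0" "0 < (LINT x|Q. g x * X x)"
proof -
  \<comment> \<open>The ambient vector space consists of all functions, and the integral of a
    non-integrable function is 0 by default, so sublinearity of the distance may fail there.
    Composing with a linear projection \<open>\<pi>\<close> onto the integrable functions makes the
    distance sublinear everywhere.\<close>
  have "subspace {f :: 'a \<Rightarrow> real. integrable Q f}"
    by (auto simp: subspace_def plus_fun_def scaleR_fun_def zero_fun_def)
  from linear_exists_left_inverse_on[OF linear_id this] obtain \<pi> :: "('a \<Rightarrow> real) \<Rightarrow> 'a \<Rightarrow> real" where
    \<pi>_int: "\<And>f. integrable Q (\<pi> f)" and lin_\<pi>: "linear \<pi>" and
    \<pi>: "\<And>f. integrable Q f \<Longrightarrow> \<pi> f = f"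
    by (auto simp: image_subset_iff)
  let ?f = "\<lambda>c Y. LINT x|Q. \<bar>\<pi> Y x - c x\<bar>"
  let ?p = "\<lambda>Y. INF c\<in>C. ?f c Y"
  have C0: "0 \<in> C" using C by (rule convex_cone_contains_0)
  have bdd: "bdd_below ((\<lambda>c. ?f c Y) ` C)" for Y
    by (intro bdd_belowI[of _ 0]) auto
  have "sublinear ?p"
  proof (rule sublinear_INF[OF _ bdd])
    show "C \<noteq> {}" using C0 by auto
  next
    fix c c' Y Y' assume c: "c \<in> C" "c' \<in> C"
    have "?f (c + c') (Y + Y') \<le> (LINT x|Q. \<bar>\<pi> Y x - c x\<bar> + \<bar>\<pi> Y' x - c' x\<bar>)"
      using c C_int \<pi>_int by (intro integral_mono) (auto simp: linear_add[OF lin_\<pi>])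
    also have "\<dots> = ?f c Y + ?f c' Y'"
      using c C_int \<pi>_int by (intro Bochner_Integration.integral_add) auto
    finally show "\<exists>k\<in>C. ?f k (Y + Y') \<le> ?f c Y + ?f c' Y'"
      using convex_cone_add[OF C c] by blast
  next
    fix c Y and r :: real assume c: "c \<in> C" and r: "0 < r"
    have "\<bar>r * a - r * b\<bar> = r * \<bar>a - b\<bar>" for a b :: real
      using r by (simp add: abs_mult flip: right_diff_distrib)
    then have "?f (r *\<^sub>R c) (r *\<^sub>R Y) = r * ?f c Y"
      by (simp add: linear_scale[OF lin_\<pi>])
    then show "\<exists>k\<in>C. ?f k (r *\<^sub>R Y) \<le> r * ?f c Y"
      using convex_cone_scaleR[OF C _ c, of r] r by (intro bexI[of _ "r *\<^sub>R c"]) auto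
  next
    have "?p 0 \<le> 0"
      using cINF_lower[OF bdd C0, of 0] by (simp add: linear_0[OF lin_\<pi>])
    moreover have "0 \<le> ?p 0"
      using C0 by (intro cINF_greatest) auto
    ultimately show "?p 0 = 0" by linarith
  qed
  then obtain l where l: "linear l" "\<And>Y. l Y \<le> ?p Y" "l X = ?p X"
    using hahn_banach_sublinear by blast
  have l_le: "l Y \<le> (LINT x|Q. \<bar>Y x - c x\<bar>)" if "c \<in> C" "integrable Q Y" for c Y
    using l(2)[of Y] cINF_lower[OF bdd that(1), of Y] \<pi>[OF that(2)] by simp
  have l_C: "l c \<le> 0" if "c \<in> C" for c
    using l_le[OF that C_int[OF that]] by simp
  have "0 \<le> l f" if "integrable Q f" "\<And>x. 0 \<le> f x" for f
    using l_C[OF C_neg[OF that]] by (simp add: linear_neg[OF l(1)])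
  moreover have "l f \<le> (LINT x|Q. \<bar>f x\<bar>)" if "integrable Q f" for f
    using l_le[OF C0 that] by simp
  ultimately obtain g where g: "g \<in> borel_measurable Q" "\<And>x. 0 \<le> g x" "\<And>x. g x \<le> 1"
    and lg: "\<And>f. integrable Q f \<Longrightarrow> l f = (LINT x|Q. g x * f x)"
    using positive_functional_density[OF Q l(1)] by blast
  have "d \<le> ?p X" using C0 dist \<pi>[OF X] by (intro cINF_greatest) auto
  then have "0 < l X" using d l(3) by linarith
  with that[OF g] lg[OF X] lg[OF C_int] l_C show ?thesis by metis
qed

subsection \<open>The positive part of the divergence function\<close>

lemma e2ennreal_times: "0 \<le> a \<Longrightarrow> 0 \<le> x \<Longrightarrow> e2ennreal (ereal a * x) = ennreal a * e2ennreal x"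
  by (simp add: times_ennreal.abs_eq eq_onp_def flip: e2ennreal_ereal)

lemma e2ennreal_plus: "0 \<le> x \<Longrightarrow> 0 \<le> y \<Longrightarrow> e2ennreal (x + y) = e2ennreal x + e2ennreal y"
  by (simp add: plus_ennreal.abs_eq eq_onp_def)

lemma pos_part_nonneg: "0 \<le> pos_part \<Phi> y"
  by (simp add: pos_part_def)

lemma pos_part_convex:
  assumes \<Phi>: "proper_convex_halfline \<Phi>" and xy: "0 \<le> x" "0 \<le> y" and t: "0 < t" "t < 1"
  shows "e2ennreal (pos_part \<Phi> ((1 - t) * x + t * y)) \<le>
    ennreal (1 - t) * e2ennreal (pos_part \<Phi> x) + ennreal t * e2ennreal (pos_part \<Phi> y)"
proof -
  have "\<Phi> ((1 - t) * x + t * y) \<le> ereal (1 - t) * \<Phi> x + ereal t * \<Phi> y"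
    using \<Phi> xy t unfolding proper_convex_halfline_def by blast
  also have "\<dots> \<le> ereal (1 - t) * pos_part \<Phi> x + ereal t * pos_part \<Phi> y"
    using t by (intro add_mono ereal_mult_left_mono) (auto simp: pos_part_def)
  finally have "pos_part \<Phi> ((1 - t) * x + t * y) \<le> ereal (1 - t) * pos_part \<Phi> x + ereal t * pos_part \<Phi> y"
    using t by (auto simp: pos_part_def[of _ "_ + _"] intro!: add_nonneg_nonneg)
       (auto simp: pos_part_def)
  then have "e2ennreal (pos_part \<Phi> ((1 - t) * x + t * y)) \<le>
      e2ennreal (ereal (1 - t) * pos_part \<Phi> x + ereal t * pos_part \<Phi> y)"
    by (rule e2ennreal_mono)
  also have "\<dots> = ennreal (1 - t) * e2ennreal (pos_part \<Phi> x) + ennreal t * e2ennreal (pos_part \<Phi> y)"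
    using t by (simp add: e2ennreal_plus e2ennreal_times pos_part_nonneg)
  finally show ?thesis .
qed

lemma proper_convex_halfline_real:
  assumes "proper_convex_halfline \<Phi>" "0 < y"
  shows "\<Phi> y = ereal (real_of_ereal (\<Phi> y))"
  using assms by (cases "\<Phi> y") (auto simp: proper_convex_halfline_def dest!: spec[of _ y])

lemma pos_part_finite:
  assumes "proper_convex_halfline \<Phi>" "0 < y"
  shows "e2ennreal (pos_part \<Phi> y) < \<infinity>"
  by (subst pos_part_def, subst proper_convex_halfline_real[OF assms])
    (simp add: max_def zero_ereal_def)

text \<open>Convexity bounds the value at an intermediate point by a convex combination of the
  endpoint values; both weights are then replaced by 1.\<close>

lemma pos_part_between:
  assumes \<Phi>: "proper_convex_halfline \<Phi>" and z: "0 \<le> a" "a \<le> z" "z \<le> b"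
  shows "e2ennreal (pos_part \<Phi> z) \<le> e2ennreal (pos_part \<Phi> a) + e2ennreal (pos_part \<Phi> b)"
proof (cases "z = a \<or> z = b")
  case False
  define t where "t = (z - a) / (b - a)"
  have t: "0 < t" "t < 1" and "t * (b - a) = z - a"
    using z False by (auto simp: t_def)
  then have zt: "z = (1 - t) * a + t * b" by (simp add: algebra_simps)
  have "e2ennreal (pos_part \<Phi> z) \<le>
      ennreal (1 - t) * e2ennreal (pos_part \<Phi> a) + ennreal t * e2ennreal (pos_part \<Phi> b)"
    unfolding zt using z t by (intro pos_part_convex[OF \<Phi>]) auto
  also have "\<dots> \<le> 1 * e2ennreal (pos_part \<Phi> a) + 1 * e2ennreal (pos_part \<Phi> b)"
    using t by (intro add_mono mult_right_mono) (auto simp: ennreal_le_1)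
  finally show ?thesis by simp
qed auto

text \<open>Densities may vanish, but the growth condition speaks only of \<open>y > 0\<close>. At
  \<open>y = 0\<close> both arguments of \<Phi> are 0, so a factor of at least 1 is enough even if
  the value is infinite; this is why \<alpha> is raised to \<open>max 1 \<alpha>\<close>.\<close>

lemma pos_part_growth:
  assumes "growth_condition \<Phi>" "0 < l0" "l0 \<le> l1"
  obtains \<alpha> \<beta> :: real where "1 \<le> \<alpha>" "0 < \<beta>"
    "\<And>y l. 0 \<le> y \<Longrightarrow> l0 \<le> l \<Longrightarrow> l \<le> l1 \<Longrightarrow>
      e2ennreal (pos_part \<Phi> (l * y)) \<le> ennreal \<alpha> * e2ennreal (pos_part \<Phi> y) + ennreal (\<beta> * (y + 1))"
proof -
  obtain \<alpha> \<beta> where ab: "0 < \<alpha>" "0 < \<beta>" and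
    grow: "\<And>y l. 0 < y \<Longrightarrow> l \<in> {l0..l1} \<Longrightarrow> pos_part \<Phi> (l * y) \<le> ereal \<alpha> * pos_part \<Phi> y + ereal (\<beta> * (y + 1))"
    using assms(1)[unfolded growth_condition_def, rule_format, OF conjI[OF assms(2,3)]] by blast
  show ?thesis
  proof (rule that[of "max 1 \<alpha>" \<beta>])
    fix y l :: real assume y: "0 \<le> y" and l: "l0 \<le> l" "l \<le> l1"
    show "e2ennreal (pos_part \<Phi> (l * y)) \<le>
      ennreal (max 1 \<alpha>) * e2ennreal (pos_part \<Phi> y) + ennreal (\<beta> * (y + 1))"
    proof (cases "y = 0")
      case True
      have "1 * e2ennreal (pos_part \<Phi> 0) \<le> ennreal (max 1 \<alpha>) * e2ennreal (pos_part \<Phi> 0)"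
        using ennreal_leI[of 1 "max 1 \<alpha>"] by (intro mult_right_mono) auto
      then show ?thesis using True by (simp add: add_increasing2)
    next
      case False
      have "e2ennreal (pos_part \<Phi> (l * y)) \<le> e2ennreal (ereal \<alpha> * pos_part \<Phi> y + ereal (\<beta> * (y + 1)))"
        using grow[of y l] y False l by (intro e2ennreal_mono) auto
      also have "\<dots> = ennreal \<alpha> * e2ennreal (pos_part \<Phi> y) + ennreal (\<beta> * (y + 1))"
        using ab y by (simp add: e2ennreal_plus e2ennreal_times pos_part_nonneg)
      also have "\<dots> \<le> ennreal (max 1 \<alpha>) * e2ennreal (pos_part \<Phi> y) + ennreal (\<beta> * (y + 1))"
        using y by (intro add_mono mult_right_mono ennreal_leI) auto
      finally show ?thesis .
    qed
  qed (use ab in auto)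
qed

text \<open>On the open half-line \<Phi> is finite and convex, hence continuous. The point 0, where
  \<Phi> may jump or be infinite, is treated as a separate case.\<close>

lemma measurable_pos_part:
  assumes \<Phi>: "proper_convex_halfline \<Phi>" and w[measurable]: "w \<in> borel_measurable P" and w0: "\<And>x. 0 \<le> w x"
  shows "(\<lambda>x. e2ennreal (pos_part \<Phi> (w x))) \<in> borel_measurable P"
proof -
  let ?h = "\<lambda>y. real_of_ereal (\<Phi> y)"
  note fin = proper_convex_halfline_real[OF \<Phi>]
  have "convex_on {0<..} ?h"
  proof (rule convex_onI)
    fix t x y :: real assume t: "0 < t" "t < 1" and xy: "x \<in> {0<..}" "y \<in> {0<..}"
    have pos: "0 < (1 - t) * x + t * y" using t xy by (simp add: add_pos_pos)
    have "\<Phi> ((1 - t) * x + t * y) \<le> ereal (1 - t) * \<Phi> x + ereal t * \<Phi> y"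
      using \<Phi> t xy unfolding proper_convex_halfline_def by auto
    then have "ereal (?h ((1 - t) * x + t * y)) \<le> ereal ((1 - t) * ?h x + t * ?h y)"
      using fin[OF pos] fin[of x] fin[of y] xy by (metis greaterThan_iff plus_ereal.simps(1) times_ereal.simps(1))
    then show "?h ((1 - t) *\<^sub>R x + t *\<^sub>R y) \<le> (1 - t) * ?h x + t * ?h y"
      by simp
  qed simp
  then have "continuous_on {0<..} ?h" by (intro convex_on_continuous) auto
  then have [measurable]: "(\<lambda>y. indicator {0<..} y *\<^sub>R ?h y) \<in> borel_measurable borel"
    by (intro borel_measurable_continuous_on_indicator) auto
  have "e2ennreal (pos_part \<Phi> (w x)) =
      (if w x = 0 then e2ennreal (pos_part \<Phi> 0) else ennreal (max (indicator {0<..} (w x) *\<^sub>R ?h (w x)) 0))" for x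
  proof (cases "w x = 0")
    case False
    with w0[of x] have w: "0 < w x" by simp
    then obtain r where "\<Phi> (w x) = ereal r" using fin by metis
    with w show ?thesis by (auto simp: pos_part_def max_def zero_ereal_def)
  qed simp
  then show ?thesis by simp
qed

subsection \<open>Measures given by densities\<close>

text \<open>The conversion \<open>enn2real\<close> would send an infinite derivative to 0, but
  \<open>Q\<close> is \<sigma>-finite, so its derivative is finite almost everywhere and no mass is
  lost.\<close>

lemma M1_density_rv:
  assumes P: "prob_space P" and Q: "Q \<in> M1 P K"
  shows "Q = density P (\<lambda>x. ennreal (density_rv P Q x))"
    and "density_rv P Q \<in> borel_measurable P"
    and "integrable P (density_rv P Q)"
    and "(LINT x|P. density_rv P Q x) = 1"
proof -
  interpret P: prob_space P by fact
  interpret Q: prob_space Q using Q by (simp add: M1_def)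
  have ac: "absolutely_continuous P Q" "sets Q = sets P" using Q by (auto simp: M1_def)
  show w[measurable]: "density_rv P Q \<in> borel_measurable P"
    unfolding density_rv_def by measurable
  have "AE x in P. RN_deriv P Q x = ennreal (density_rv P Q x)"
    using P.RN_deriv_finite[OF Q.sigma_finite_measure_axioms ac]
    by eventually_elim (simp add: density_rv_def less_top)
  then have "density P (RN_deriv P Q) = density P (\<lambda>x. ennreal (density_rv P Q x))"
    by (intro density_cong) auto
  then show eq: "Q = density P (\<lambda>x. ennreal (density_rv P Q x))"
    using P.density_RN_deriv[OF ac] by simp
  have "emeasure (density P (\<lambda>x. ennreal (density_rv P Q x))) (space P) = 1"
    unfolding eq[symmetric] using Q.emeasure_space_1 sets_eq_imp_space_eq[OF ac(2)] by simp
  then have 1: "(\<integral>\<^sup>+x. ennreal (density_rv P Q x) \<partial>P) = ennreal 1"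
    by (simp add: emeasure_density cong: nn_integral_cong_simp)
  have nn: "0 \<le> density_rv P Q x" for x by (simp add: density_rv_def)
  show "integrable P (density_rv P Q)" "(LINT x|P. density_rv P Q x) = 1"
    using nn_integral_eq_integrable[OF w, of 1] 1 nn by simp_all
qed

lemma density_rv_nonneg: "0 \<le> density_rv P Q x"
  by (simp add: density_rv_def)

lemma M1_integral_eq:
  fixes X :: "'a \<Rightarrow> real"
  assumes P: "prob_space P" and Q: "Q \<in> M1 P K" and X: "X \<in> borel_measurable P"
  shows "integrable Q X \<longleftrightarrow> integrable P (\<lambda>x. density_rv P Q x * X x)"
    and "(LINT x|Q. X x) = (LINT x|P. density_rv P Q x * X x)"
proof -
  define w where "w = density_rv P Q"
  have Qw: "Q = density P (\<lambda>x. ennreal (w x))" and w: "w \<in> borel_measurable P" "AE x in P. 0 \<le> w x"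
    using M1_density_rv[OF P Q] by (auto simp: w_def density_rv_nonneg)
  show "integrable Q X \<longleftrightarrow> integrable P (\<lambda>x. density_rv P Q x * X x)"
    "(LINT x|Q. X x) = (LINT x|P. density_rv P Q x * X x)"
    unfolding w_def[symmetric] by (simp_all add: Qw integrable_real_density integral_real_density w X)
qed

lemma M1_cone:
  assumes P: "prob_space P" and Q: "Q \<in> M1 P K" and X: "X \<in> K"
  shows "X \<in> borel_measurable P" and "integrable Q X" and "(LINT x|Q. X x) \<le> 0"
    and "integrable P (\<lambda>x. density_rv P Q x * X x)"
    and "(LINT x|P. density_rv P Q x * X x) \<le> 0"
proof -
  show 1: "X \<in> borel_measurable P" "integrable Q X" "(LINT x|Q. X x) \<le> 0"
    using Q X by (auto simp: M1_def L1_def)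
  show "integrable P (\<lambda>x. density_rv P Q x * X x)" "(LINT x|P. density_rv P Q x * X x) \<le> 0"
    using M1_integral_eq[OF P Q 1(1)] 1(2,3) by simp_all
qed

lemma density_in_M1:
  fixes w :: "'a \<Rightarrow> real"
  assumes P: "prob_space P" and w: "integrable P w" "\<And>x. 0 \<le> w x" "(LINT x|P. w x) = 1"
    and K: "K \<subseteq> borel_measurable P" "\<And>X. X \<in> K \<Longrightarrow> integrable P (\<lambda>x. w x * X x)"
      "\<And>X. X \<in> K \<Longrightarrow> (LINT x|P. w x * X x) \<le> 0"
  shows "density P (\<lambda>x. ennreal (w x)) \<in> M1 P K"
    and "AE x in P. density_rv P (density P (\<lambda>x. ennreal (w x))) x = w x"
proof -
  interpret P: prob_space P by fact
  have [measurable]: "w \<in> borel_measurable P" using w(1) by auto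
  have "prob_space (density P (\<lambda>x. ennreal (w x)))"
  proof (rule prob_spaceI)
    have "(\<integral>\<^sup>+x. ennreal (w x) \<partial>P) = 1"
      using nn_integral_eq_integral[OF w(1)] w by simp
    then show "emeasure (density P (\<lambda>x. ennreal (w x))) (space (density P (\<lambda>x. ennreal (w x)))) = 1"
      by (simp add: emeasure_density cong: nn_integral_cong_simp)
  qed
  moreover have "absolutely_continuous P (density P (\<lambda>x. ennreal (w x)))"
    by (rule absolutely_continuousI_density) simp
  moreover have "X \<in> L1 P (density P (\<lambda>x. ennreal (w x)))"
    "(LINT x|density P (\<lambda>x. ennreal (w x)). X x) \<le> 0" if "X \<in> K" for X
    using that K w by (auto simp: L1_def subset_eq integrable_real_density integral_real_density)
  ultimately show "density P (\<lambda>x. ennreal (w x)) \<in> M1 P K"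
    by (auto simp: M1_def)
  show "AE x in P. density_rv P (density P (\<lambda>x. ennreal (w x))) x = w x"
  proof -
    have "AE x in P. ennreal (w x) = RN_deriv P (density P (\<lambda>x. ennreal (w x))) x"
      by (rule P.RN_deriv_unique) auto
    then show ?thesis
      by eventually_elim (metis density_rv_def enn2real_ennreal w(2))
  qed
qed

lemma density_in_M_Phi:
  fixes w :: "'a \<Rightarrow> real"
  assumes P: "prob_space P" and w: "integrable P w" "\<And>x. 0 \<le> w x" "(LINT x|P. w x) = 1"
    and K: "K \<subseteq> borel_measurable P" "\<And>X. X \<in> K \<Longrightarrow> integrable P (\<lambda>x. w x * X x)"
      "\<And>X. X \<in> K \<Longrightarrow> (LINT x|P. w x * X x) \<le> 0"
    and \<Phi>: "(\<integral>\<^sup>+x. e2ennreal (pos_part \<Phi> (w x)) \<partial>P) < \<infinity>"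
  shows "density P (\<lambda>x. ennreal (w x)) \<in> M_Phi P K \<Phi>"
proof -
  note d = density_in_M1[OF P w K]
  have "(\<integral>\<^sup>+x. e2ennreal (pos_part \<Phi> (density_rv P (density P (\<lambda>x. ennreal (w x))) x)) \<partial>P) =
      (\<integral>\<^sup>+x. e2ennreal (pos_part \<Phi> (w x)) \<partial>P)"
    using d(2) by (intro nn_integral_cong_AE) auto
  with d(1) \<Phi> show ?thesis by (simp add: M_Phi_def)
qed

section \<open>Polars as expectation inequalities, and their weak closedness\<close>

text \<open>The pairing depends only on the almost sure class of the density, so all versions in
  \<open>R_image\<close> impose the same constraint, and a change of measure turns it into an
  expectation. No integrability under \<open>Q\<close> is presupposed: the identity of integrals
  also covers the default value 0.\<close>

lemma polar_R_image:
  assumes P: "prob_space P" and M: "M \<subseteq> M1 P K" and E: "E \<subseteq> borel_measurable P"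
  shows "polar P E (R_image P M) = {z \<in> E. \<forall>Q\<in>M. (LINT x|Q. z x) \<le> 0}"
proof -
  have pair: "pairing P z w = (LINT x|Q. z x)"
    if "z \<in> E" "Q \<in> M" "w \<in> borel_measurable P" "AE x in P. w x = density_rv P Q x" for z Q w
  proof -
    have [measurable]: "z \<in> borel_measurable P" "w \<in> borel_measurable P"
      "density_rv P Q \<in> borel_measurable P"
      using that M E M1_density_rv[OF P, of Q K] by auto
    have "(LINT x|Q. z x) = (LINT x|P. density_rv P Q x * z x)"
      using that M E by (intro M1_integral_eq[OF P]) auto
    also have "\<dots> = pairing P z w"
      unfolding pairing_def using that(4) by (intro integral_cong_AE) auto
    finally show ?thesis by simp
  qed
  have "density_rv P Q \<in> R_image P M" if "Q \<in> M" for Q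
    using that M M1_density_rv[OF P, of Q K] by (auto simp: R_image_def)
  moreover have "pairing P z (density_rv P Q) = (LINT x|Q. z x)" if "z \<in> E" "Q \<in> M" for z Q
    using that M M1_density_rv[OF P, of Q K] by (intro pair) auto
  ultimately have "polar P E (R_image P M) \<subseteq> {z \<in> E. \<forall>Q\<in>M. (LINT x|Q. z x) \<le> 0}"
    by (force simp: polar_def)
  moreover have "{z \<in> E. \<forall>Q\<in>M. (LINT x|Q. z x) \<le> 0} \<subseteq> polar P E (R_image P M)"
    by (auto simp: polar_def R_image_def pair)
  ultimately show ?thesis by blast
qed

lemma closedin_weak_polar:
  assumes "F \<noteq> {}" and "B \<subseteq> F"
  shows "closedin (weak_topology P E F) (polar P E B)"
proof -
  let ?T = "weak_topology P E F"
  have basis: "openin ?T {z \<in> E. pairing P z w \<in> U}" if "w \<in> F" "open U" for w U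
    unfolding weak_topology_def using that by (intro topology_generated_by_Basis) blast
  have "topspace ?T \<subseteq> E"
    unfolding weak_topology_def by auto
  \<comment> \<open>A topology generated by an empty family has an empty carrier; one
    \<open>w\<close> in \<open>F\<close> together with \<open>UNIV\<close> already makes all of
    \<open>E\<close> open.\<close>
  moreover obtain w where "w \<in> F" using assms(1) by blast
  then have "E \<subseteq> topspace ?T"
    using openin_subset[OF basis[of w UNIV]] by simp
  ultimately have top: "topspace ?T = E" by blast
  have "E - polar P E B = (\<Union>w\<in>B. {z \<in> E. pairing P z w \<in> {0<..}})"
    by (auto simp: polar_def not_le)
  moreover have "openin ?T (\<Union>w\<in>B. {z \<in> E. pairing P z w \<in> {0<..}})"
    using assms(2) by (intro openin_clauses(3)) (auto intro!: basis simp del: greaterThan_iff)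
  ultimately show ?thesis
    unfolding closedin_def top by (auto simp: polar_def)
qed

subsection \<open>The polar wedges\<close>

text \<open>The truncated condition on \<open>Q\<close> says nothing about small values of its
  density. Adding \<open>t * w0\<close> repairs this, because the growth condition makes the
  positive part of \<Phi> integrable along \<open>t * w0\<close>.\<close>

lemma M_Phi_hat_mix:
  assumes P: "prob_space P" and \<Phi>: "proper_convex_halfline \<Phi>" "growth_condition \<Phi>"
    and Q: "Q \<in> M_Phi_hat P K \<Phi>" and Q0: "Q0 \<in> M_Phi P K \<Phi>" and t: "0 < t" "t < 1"
  shows "density P (\<lambda>x. ennreal ((1 - t) * density_rv P Q x + t * density_rv P Q0 x)) \<in> M_Phi P K \<Phi>"
proof -
  interpret prob_space P by fact
  define w where "w = density_rv P Q"
  define w0 where "w0 = density_rv P Q0"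
  define \<phi> where "\<phi> y = e2ennreal (pos_part \<Phi> y)" for y
  have M1: "Q \<in> M1 P K" "Q0 \<in> M1 P K" using Q Q0 by (auto simp: M_Phi_def M_Phi_hat_def)
  have w: "integrable P w" "(LINT x|P. w x) = 1" "integrable P w0" "(LINT x|P. w0 x) = 1"
    using M1_density_rv[OF P M1(1)] M1_density_rv[OF P M1(2)] by (auto simp: w_def w0_def)
  have [measurable]: "w \<in> borel_measurable P" "w0 \<in> borel_measurable P" using w by auto
  have nn: "0 \<le> w x" "0 \<le> w0 x" for x by (auto simp: w_def w0_def density_rv_nonneg)
  have Kb: "K \<subseteq> borel_measurable P" using M1 by (auto simp: M1_def L1_def)
  have Ki: "integrable P (\<lambda>x. w x * X x)" "(LINT x|P. w x * X x) \<le> 0"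
    "integrable P (\<lambda>x. w0 x * X x)" "(LINT x|P. w0 x * X x) \<le> 0" if "X \<in> K" for X
    using M1_cone(4,5)[OF P M1(1) that] M1_cone(4,5)[OF P M1(2) that] by (simp_all add: w_def w0_def)
  have [measurable]: "(\<lambda>x. \<phi> (w x)) \<in> borel_measurable P" "(\<lambda>x. \<phi> (w0 x)) \<in> borel_measurable P"
    unfolding \<phi>_def by (simp_all add: measurable_pos_part[OF \<Phi>(1)] nn)
  \<comment> \<open>Only the factor \<open>t\<close> occurs, so the growth condition is taken on the
    degenerate interval from \<open>t\<close> to \<open>t\<close>.\<close>
  obtain \<alpha> \<beta> where ab: "1 \<le> \<alpha>" "0 < \<beta>" and
    grow: "\<And>y l. 0 \<le> y \<Longrightarrow> t \<le> l \<Longrightarrow> l \<le> t \<Longrightarrow> \<phi> (l * y) \<le> ennreal \<alpha> * \<phi> y + ennreal (\<beta> * (y + 1))"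
    using pos_part_growth[OF \<Phi>(2) t(1) order.refl] unfolding \<phi>_def by blast
  let ?b = "\<lambda>x. \<phi> (w x) * indicator {x. 1 \<le> w x} x +
    ((ennreal \<alpha> * \<phi> (w0 x) + ennreal (\<beta> * (w0 x + 1))) + (\<phi> 1 + \<phi> (w0 x)))"
  \<comment> \<open>Where \<open>w x < 1\<close>, the mixture lies between \<open>t * w0 x\<close> and \<open>(1 - t) * 1 + t * w0 x\<close>, so the
    possible blow-up of \<open>\<Phi>\<close> at 0 is controlled by \<open>w0\<close> alone.\<close>
  have bound: "\<phi> ((1 - t) * w x + t * w0 x) \<le> ?b x" for x
  proof (cases "1 \<le> w x")
    case True
    have "\<phi> ((1 - t) * w x + t * w0 x) \<le> ennreal (1 - t) * \<phi> (w x) + ennreal t * \<phi> (w0 x)"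
      unfolding \<phi>_def using nn t by (intro pos_part_convex[OF \<Phi>(1)])
    also have "\<dots> \<le> 1 * \<phi> (w x) + 1 * \<phi> (w0 x)"
      using t by (intro add_mono mult_right_mono) (auto simp: ennreal_le_1)
    also have "\<dots> \<le> ?b x"
      using True by (auto intro!: add_mono add_increasing)
    finally show ?thesis .
  next
    case False
    have "\<phi> ((1 - t) * w x + t * w0 x) \<le> \<phi> (t * w0 x) + \<phi> ((1 - t) * 1 + t * w0 x)"
      unfolding \<phi>_def using nn[of x] t False
      by (intro pos_part_between[OF \<Phi>(1)] add_right_mono mult_left_mono) auto
    also have "\<dots> \<le> (ennreal \<alpha> * \<phi> (w0 x) + ennreal (\<beta> * (w0 x + 1))) +
        (ennreal (1 - t) * \<phi> 1 + ennreal t * \<phi> (w0 x))"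
      unfolding \<phi>_def using nn t grow[of "w0 x" t, unfolded \<phi>_def]
      by (intro add_mono pos_part_convex[OF \<Phi>(1)]) auto
    also have "\<dots> \<le> (ennreal \<alpha> * \<phi> (w0 x) + ennreal (\<beta> * (w0 x + 1))) + (1 * \<phi> 1 + 1 * \<phi> (w0 x))"
      using t by (intro add_mono mult_right_mono) (auto simp: ennreal_le_1)
    also have "\<dots> \<le> ?b x" by (simp add: add_increasing)
    finally show ?thesis .
  qed
  have fin1: "(\<integral>\<^sup>+x. \<phi> (w x) * indicator {x. 1 \<le> w x} x \<partial>P) < \<infinity>"
    using Q by (simp add: M_Phi_hat_def w_def \<phi>_def)
  have fin0: "(\<integral>\<^sup>+x. \<phi> (w0 x) \<partial>P) < \<infinity>"
    using Q0 by (simp add: M_Phi_def w0_def \<phi>_def)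
  have finw: "(\<integral>\<^sup>+x. ennreal (\<beta> * (w0 x + 1)) \<partial>P) < \<infinity>"
    using w ab nn by (subst nn_integral_eq_integral) auto
  have "(\<integral>\<^sup>+x. \<phi> ((1 - t) * w x + t * w0 x) \<partial>P) \<le> (\<integral>\<^sup>+x. ?b x \<partial>P)"
    by (intro nn_integral_mono bound)
  also have "\<dots> = (\<integral>\<^sup>+x. \<phi> (w x) * indicator {x. 1 \<le> w x} x \<partial>P) +
      ((ennreal \<alpha> * (\<integral>\<^sup>+x. \<phi> (w0 x) \<partial>P) + (\<integral>\<^sup>+x. ennreal (\<beta> * (w0 x + 1)) \<partial>P)) +
       (\<phi> 1 + (\<integral>\<^sup>+x. \<phi> (w0 x) \<partial>P)))"
    by (simp add: nn_integral_add nn_integral_cmult emeasure_space_1)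
  also have "\<dots> < \<infinity>"
    using fin1 fin0 finw pos_part_finite[OF \<Phi>(1), of 1] by (simp add: ennreal_mult_less_top \<phi>_def)
  finally have fin: "(\<integral>\<^sup>+x. \<phi> ((1 - t) * w x + t * w0 x) \<partial>P) < \<infinity>" .
  have mixK: "((1 - t) * w x + t * w0 x) * X x = (1 - t) * (w x * X x) + t * (w0 x * X x)"
    for x and X :: "'a \<Rightarrow> real" by (simp add: algebra_simps)
  have "density P (\<lambda>x. ennreal ((1 - t) * w x + t * w0 x)) \<in> M_Phi P K \<Phi>"
  proof (rule density_in_M_Phi[OF P])
    fix X assume X: "X \<in> K"
    show "(LINT x|P. ((1 - t) * w x + t * w0 x) * X x) \<le> 0"
      unfolding mixK using t Ki[OF X] by (simp add: add_nonpos_nonpos mult_nonneg_nonpos)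
    show "integrable P (\<lambda>x. ((1 - t) * w x + t * w0 x) * X x)"
      unfolding mixK using Ki[OF X] by simp
  qed (use w nn t Kb fin in \<open>auto simp: \<phi>_def\<close>)
  then show ?thesis by (simp add: w_def w0_def)
qed

text \<open>Each mixture lies in \<open>M_Phi\<close>, so \<open>(1 - t) * a + t * b \<le> 0\<close>
  for the two expectations \<open>a\<close> and \<open>b\<close> of \<open>z\<close>; letting
  \<open>t\<close> tend to 0 leaves \<open>a \<le> 0\<close>.\<close>

lemma integral_M_Phi_hat_le:
  assumes P: "prob_space P" and \<Phi>: "proper_convex_halfline \<Phi>" "growth_condition \<Phi>"
    and Q: "Q \<in> M_Phi_hat P K \<Phi>" and Q0: "Q0 \<in> M_Phi P K \<Phi>"
    and z: "z \<in> E_Phi P K \<Phi>" and le: "\<And>Q. Q \<in> M_Phi P K \<Phi> \<Longrightarrow> (LINT x|Q. z x) \<le> 0"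
  shows "(LINT x|Q. z x) \<le> 0"
proof -
  define w where "w = density_rv P Q"
  define w0 where "w0 = density_rv P Q0"
  have M1: "Q \<in> M1 P K" "Q0 \<in> M1 P K" using Q Q0 by (auto simp: M_Phi_def M_Phi_hat_def)
  have [measurable]: "w \<in> borel_measurable P" "w0 \<in> borel_measurable P"
    using M1_density_rv[OF P M1(1)] M1_density_rv[OF P M1(2)] by (auto simp: w_def w0_def)
  have nn: "0 \<le> w x" "0 \<le> w0 x" for x by (auto simp: w_def w0_def density_rv_nonneg)
  have z_meas[measurable]: "z \<in> borel_measurable P" and "integrable Q0 z"
    using z Q0 by (auto simp: E_Phi_def L1_def)
  then have int0: "integrable P (\<lambda>x. w0 x * z x)"
    using M1_integral_eq[OF P M1(2)] by (simp add: w0_def)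
  have mix: "integrable P (\<lambda>x. ((1 - t) * w x + t * w0 x) * z x)"
      "(LINT x|P. ((1 - t) * w x + t * w0 x) * z x) \<le> 0" if t: "0 < t" "t < 1" for t
  proof -
    have "density P (\<lambda>x. ennreal ((1 - t) * w x + t * w0 x)) \<in> M_Phi P K \<Phi>" (is "?D \<in> _")
      unfolding w_def w0_def by (rule M_Phi_hat_mix[OF P \<Phi> Q Q0 t])
    then have "integrable ?D z" "(LINT x|?D. z x) \<le> 0"
      using z le by (auto simp: E_Phi_def L1_def)
    moreover have "AE x in P. 0 \<le> (1 - t) * w x + t * w0 x" using t nn by auto
    ultimately show "integrable P (\<lambda>x. ((1 - t) * w x + t * w0 x) * z x)"
      "(LINT x|P. ((1 - t) * w x + t * w0 x) * z x) \<le> 0"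
      by (simp_all add: integrable_real_density integral_real_density)
  qed
  \<comment> \<open>Membership in \<open>E_Phi\<close> does not directly give integrability under
    \<open>Q\<close>, which may lie outside \<open>M_Phi\<close>. It is recovered by writing
    \<open>w\<close> as twice the mixture at \<open>t = 1/2\<close> minus \<open>w0\<close>.\<close>
  have int: "integrable P (\<lambda>x. w x * z x)"
  proof -
    have "integrable P (\<lambda>x. 2 * (((1 - 1/2) * w x + 1/2 * w0 x) * z x) - w0 x * z x)"
      using mix(1)[of "1/2"] int0 by (intro Bochner_Integration.integrable_diff integrable_mult_right) auto
    then show ?thesis by (simp add: algebra_simps)
  qed
  define a where "a = (LINT x|P. w x * z x)"
  define b where "b = (LINT x|P. w0 x * z x)"
  have ab: "(1 - t) * a + t * b \<le> 0" if t: "0 < t" "t < 1" for t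
  proof -
    have "(LINT x|P. ((1 - t) * w x + t * w0 x) * z x) =
        (LINT x|P. (1 - t) * (w x * z x) + t * (w0 x * z x))"
      by (intro Bochner_Integration.integral_cong refl) (simp add: algebra_simps)
    also have "\<dots> = (1 - t) * a + t * b" using int int0 by (simp add: a_def b_def)
    finally show ?thesis using mix(2)[OF t] by simp
  qed
  have "a \<le> 0"
  proof (rule ccontr)
    assume "\<not> a \<le> 0"
    then have a: "0 < a" by simp
    \<comment> \<open>This choice gives \<open>(1 - t) * a + t * b \<ge> a - t * (a + \<bar>b\<bar>)
      = a / 2 > 0\<close>.\<close>
    define t where "t = a / (2 * (a + \<bar>b\<bar>))"
    have t: "0 < t" "t < 1" and ta: "t * (a + \<bar>b\<bar>) = a / 2"
      using a by (auto simp: t_def field_simps)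
    have "t * - \<bar>b\<bar> \<le> t * b" using t by (intro mult_left_mono) auto
    then show False using ab[OF t] ta a by (simp add: algebra_simps)
  qed
  then show ?thesis using M1_integral_eq(2)[OF P M1(1) z_meas] by (simp add: a_def w_def)
qed

section \<open>The \<open>L1\<close> closure of the cone and non-positive expectations\<close>

lemma integral_L1_closure_le:
  assumes P: "prob_space P" and Q: "Q \<in> M1 P K"
    and z: "z \<in> L1_closure P Q {X - Y | X Y. X \<in> K \<and> Y \<in> L1_plus P Q}"
  shows "(LINT x|Q. z x) \<le> 0"
proof -
  have zi: "integrable Q z" using z by (simp add: L1_closure_def L1_def)
  obtain Xs where Xs: "\<And>n. Xs n \<in> {X - Y | X Y. X \<in> K \<and> Y \<in> L1_plus P Q}"
    and lim: "(\<lambda>n. \<integral>\<^sup>+x. ennreal \<bar>z x - Xs n x\<bar> \<partial>Q) \<longlonglongrightarrow> 0"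
    using z unfolding L1_closure_def by blast
  \<comment> \<open>Elements of the cone have non-positive expectation, so that of \<open>z\<close>
    is at most its \<open>L1\<close> distance to each of them. Since \<open>ennreal\<close> sends
    negative reals to 0, a bound by 0 in the limit still expresses exactly the desired sign.\<close>
  have "ennreal (LINT x|Q. z x) \<le> (\<integral>\<^sup>+x. ennreal \<bar>z x - Xs n x\<bar> \<partial>Q)" for n
  proof -
    obtain X Y where XY: "Xs n = X - Y" "X \<in> K" "Y \<in> L1_plus P Q" using Xs[of n] by blast
    have i: "integrable Q X" "integrable Q Y" "(LINT x|Q. X x) \<le> 0"
      using XY Q by (auto simp: M1_def L1_def L1_plus_def)
    have "AE x in Q. 0 \<le> Y x"
      using XY(3) Q by (intro absolutely_continuous_AE[of Q P]) (auto simp: M1_def L1_plus_def)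
    then have "0 \<le> (LINT x|Q. Y x)" by (rule integral_nonneg_AE)
    then have "(LINT x|Q. z x) \<le> (LINT x|Q. z x) - (LINT x|Q. X x) + (LINT x|Q. Y x)"
      using i(3) by simp
    also have "\<dots> = (LINT x|Q. z x - Xs n x)" using zi i XY(1) by simp
    also have "\<dots> \<le> (LINT x|Q. \<bar>z x - Xs n x\<bar>)" using zi i XY(1) by (intro integral_mono) auto
    finally have "ennreal (LINT x|Q. z x) \<le> ennreal (LINT x|Q. \<bar>z x - Xs n x\<bar>)" by (rule ennreal_leI)
    also have "\<dots> = (\<integral>\<^sup>+x. ennreal \<bar>z x - Xs n x\<bar> \<partial>Q)"
      using zi i XY(1) by (intro nn_integral_eq_integral[symmetric]) auto
    finally show ?thesis .
  qed
  then have "ennreal (LINT x|Q. z x) \<le> 0"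
    by (intro LIMSEQ_le_const[OF lim]) auto
  then show ?thesis by (simp add: ennreal_eq_0_iff)
qed

text \<open>The growth condition is applied pointwise with the varying factor \<open>h x\<close>, so
  its constants have to be uniform over the whole interval from \<open>l0\<close> to
  \<open>l1\<close>. The upper bound on \<open>h\<close> also preserves integrability of the
  elements of \<open>K\<close>.\<close>

lemma density_bounded_in_M_Phi:
  assumes P: "prob_space P" and \<Phi>: "proper_convex_halfline \<Phi>" "growth_condition \<Phi>"
    and Q: "Q \<in> M_Phi P K \<Phi>" and h[measurable]: "h \<in> borel_measurable P"
    and l: "0 < l0" "\<And>x. l0 \<le> h x" "\<And>x. h x \<le> l1"
    and h1: "(LINT x|Q. h x) = 1" and hK: "\<And>X. X \<in> K \<Longrightarrow> (LINT x|Q. h x * X x) \<le> 0"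
  shows "density P (\<lambda>x. ennreal (h x * density_rv P Q x)) \<in> M_Phi P K \<Phi>"
proof -
  interpret prob_space P by fact
  define w where "w = density_rv P Q"
  have M1: "Q \<in> M1 P K" using Q by (auto simp: M_Phi_def)
  have w: "integrable P w" using M1_density_rv[OF P M1] by (simp add: w_def)
  then have [measurable]: "w \<in> borel_measurable P" by auto
  have nn: "0 \<le> w x" for x by (simp add: w_def density_rv_nonneg)
  have h_abs: "\<bar>h x * y\<bar> \<le> \<bar>l1 * y\<bar>" for x y
    using l(1) l(2,3)[of x] by (simp add: abs_mult mult_right_mono)
  have int: "integrable P (\<lambda>x. h x * f x)" if "integrable P f" for f :: "_ \<Rightarrow> real"
  proof (rule Bochner_Integration.integrable_bound)
    show "integrable P (\<lambda>x. l1 * f x)" using that by simp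
    show "AE x in P. norm (h x * f x) \<le> norm (l1 * f x)"
      by (rule AE_I2) (simp only: real_norm_def h_abs)
  qed (use that in measurable)
  have eq: "(LINT x|Q. h x * X x) = (LINT x|P. h x * w x * X x)"
    if "X \<in> borel_measurable P" for X
    using M1_integral_eq(2)[OF P M1, of "\<lambda>x. h x * X x"] that by (simp add: w_def ac_simps)
  have K: "integrable P (\<lambda>x. h x * w x * X x)" "(LINT x|P. h x * w x * X x) \<le> 0" if "X \<in> K" for X
    using int[OF M1_cone(4)[OF P M1 that]] hK[OF that] eq[OF M1_cone(1)[OF P M1 that]]
    by (simp_all add: w_def ac_simps)
  obtain \<alpha> \<beta> where ab: "1 \<le> \<alpha>" "0 < \<beta>" and
    grow: "\<And>y l. 0 \<le> y \<Longrightarrow> l0 \<le> l \<Longrightarrow> l \<le> l1 \<Longrightarrow>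
      e2ennreal (pos_part \<Phi> (l * y)) \<le> ennreal \<alpha> * e2ennreal (pos_part \<Phi> y) + ennreal (\<beta> * (y + 1))"
    using pos_part_growth[OF \<Phi>(2) l(1) order.trans[OF l(2,3)]] by blast
  have [measurable]: "(\<lambda>x. e2ennreal (pos_part \<Phi> (w x))) \<in> borel_measurable P"
    by (simp add: measurable_pos_part[OF \<Phi>(1)] nn)
  have fin0: "(\<integral>\<^sup>+x. e2ennreal (pos_part \<Phi> (w x)) \<partial>P) < \<infinity>"
    using Q by (simp add: M_Phi_def w_def)
  have finw: "(\<integral>\<^sup>+x. ennreal (\<beta> * (w x + 1)) \<partial>P) < \<infinity>"
    using w ab nn by (subst nn_integral_eq_integral) auto
  have "(\<integral>\<^sup>+x. e2ennreal (pos_part \<Phi> (h x * w x)) \<partial>P) \<le>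
      (\<integral>\<^sup>+x. ennreal \<alpha> * e2ennreal (pos_part \<Phi> (w x)) + ennreal (\<beta> * (w x + 1)) \<partial>P)"
    by (intro nn_integral_mono grow nn l)
  also have "\<dots> = ennreal \<alpha> * (\<integral>\<^sup>+x. e2ennreal (pos_part \<Phi> (w x)) \<partial>P) +
      (\<integral>\<^sup>+x. ennreal (\<beta> * (w x + 1)) \<partial>P)"
    by (simp add: nn_integral_add nn_integral_cmult)
  also have "\<dots> < \<infinity>"
    using fin0 finw by (simp add: ennreal_mult_less_top)
  finally have fin: "(\<integral>\<^sup>+x. e2ennreal (pos_part \<Phi> (h x * w x)) \<partial>P) < \<infinity>" .
  show ?thesis
    unfolding w_def[symmetric]
  proof (rule density_in_M_Phi[OF P _ _ _ _ K fin])
    show "integrable P (\<lambda>x. h x * w x)" using int[OF w] .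
    show "0 \<le> h x * w x" for x using l(1) l(2)[of x] nn[of x] by simp
    show "(LINT x|P. h x * w x) = 1" using eq[of "\<lambda>_. 1"] h1 by simp
    show "K \<subseteq> borel_measurable P" using M1 by (auto simp: M1_def L1_def)
  qed
qed

lemma in_L1_closure:
  assumes P: "prob_space P" and K: "convex_cone K"
    and \<Phi>: "proper_convex_halfline \<Phi>" "growth_condition \<Phi>"
    and Q: "Q \<in> M_Phi P K \<Phi>"
    and z: "z \<in> E_Phi P K \<Phi>" and le: "\<And>Q. Q \<in> M_Phi P K \<Phi> \<Longrightarrow> (LINT x|Q. z x) \<le> 0"
  shows "z \<in> L1_closure P Q {X - Y | X Y. X \<in> K \<and> Y \<in> L1_plus P Q}"
proof -
  define S where "S = {X - Y | X Y. X \<in> K \<and> Y \<in> L1_plus P Q}"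
  have M1: "Q \<in> M1 P K" using Q by (auto simp: M_Phi_def)
  then interpret Q: prob_space Q by (simp add: M1_def)
  have sets_Q[measurable_cong]: "sets Q = sets P" using M1 by (simp add: M1_def)
  have z_meas[measurable]: "z \<in> borel_measurable P" and zi: "integrable Q z"
    using z Q by (auto simp: E_Phi_def L1_def)
  have plus_0: "0 \<in> L1_plus P Q" by (simp add: L1_plus_def L1_def zero_fun_def)
  have S_I: "X - Y \<in> S" if "X \<in> K" "Y \<in> L1_plus P Q" for X Y
    using that by (auto simp: S_def)
  have S: "convex_cone S"
    unfolding convex_cone_iff
  proof (intro conjI ballI allI impI)
    show "0 \<in> S"
      using S_I[OF convex_cone_contains_0[OF K] plus_0] by simp
  next
    fix f g assume "f \<in> S" "g \<in> S"
    then obtain X Y X' Y' where fg: "f = X - Y" "g = X' - Y'" and X: "X \<in> K" "X' \<in> K"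
      and Y: "Y \<in> L1_plus P Q" "Y' \<in> L1_plus P Q" by (auto simp: S_def)
    have "Y + Y' \<in> L1_plus P Q"
      using Y by (auto simp: L1_plus_def L1_def plus_fun_def)
    then have "(X + X') - (Y + Y') \<in> S" by (rule S_I[OF convex_cone_add[OF K X]])
    also have "(X + X') - (Y + Y') = f + g" by (simp add: fg)
    finally show "f + g \<in> S" .
  next
    fix f and c :: real assume "f \<in> S" and c: "0 \<le> c"
    then obtain X Y where f: "f = X - Y" and X: "X \<in> K" and Y: "Y \<in> L1_plus P Q" by (auto simp: S_def)
    have "c *\<^sub>R Y \<in> L1_plus P Q"
      using Y c by (auto simp: L1_plus_def L1_def scaleR_fun_def)
    then have "c *\<^sub>R X - c *\<^sub>R Y \<in> S" by (rule S_I[OF convex_cone_scaleR[OF K c X]])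
    also have "c *\<^sub>R X - c *\<^sub>R Y = c *\<^sub>R f" by (simp add: f scaleR_right_diff_distrib)
    finally show "c *\<^sub>R f \<in> S" .
  qed
  have S_int: "integrable Q f" if "f \<in> S" for f
    using that M1_cone(2)[OF P M1] by (auto simp: S_def L1_plus_def L1_def fun_diff_def)
  have S_neg: "- f \<in> S" if "integrable Q f" "\<And>x. 0 \<le> f x" for f
  proof -
    have "f \<in> borel_measurable P" using borel_measurable_integrable[OF that(1)] by simp
    then have "f \<in> L1_plus P Q" using that by (simp add: L1_plus_def L1_def)
    from S_I[OF convex_cone_contains_0[OF K] this] show ?thesis by simp
  qed
  have K_S: "X \<in> S" if "X \<in> K" for X
    using S_I[OF that plus_0] by simp
  \<comment> \<open>Failure for a single \<open>n\<close> puts \<open>z\<close> at distance at least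
    \<open>1 / (n + 1)\<close> from \<open>S\<close>, which is the separation hypothesis.\<close>
  have "\<exists>f\<in>S. (LINT x|Q. \<bar>z x - f x\<bar>) < 1 / real (Suc n)" for n
  proof (rule ccontr)
    assume "\<not> ?thesis"
    then have far: "1 / real (Suc n) \<le> (LINT x|Q. \<bar>z x - f x\<bar>)" if "f \<in> S" for f
      using that by (meson not_less)
    have pos: "0 < 1 / real (Suc n)" by simp
    obtain g where g: "g \<in> borel_measurable Q" "\<And>x. 0 \<le> g x" "\<And>x. g x \<le> 1"
      and gS: "\<And>f. f \<in> S \<Longrightarrow> (LINT x|Q. g x * f x) \<le> 0" and gz: "0 < (LINT x|Q. g x * z x)"
      using L1_separation[OF Q.finite_measure_axioms S S_int S_neg zi pos far] by blast
    note [measurable] = g(1)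
    have g_int: "integrable Q (\<lambda>x. g x * f x)" if "integrable Q f" for f
      using that g(2,3)
      by (intro Bochner_Integration.integrable_bound[OF that]) (auto simp: abs_mult intro!: mult_left_le_one_le)
    define a where "a = (LINT x|Q. g x * z x)"
    define b where "b = (LINT x|Q. z x)"
    \<comment> \<open>The summand 1 keeps the denominator of \<open>e\<close> positive even if
      \<open>b = 0\<close>; then \<open>e * B = a / 2\<close> gives
      \<open>a + e * b \<ge> a / 2 > 0\<close>.\<close>
    define B where "B = \<bar>b\<bar> + 1"
    have B: "0 < B" by (simp add: B_def add_nonneg_pos)
    define e where "e = a / (2 * B)"
    have a: "0 < a" using gz by (simp add: a_def)
    have e: "0 < e" using a B by (simp add: e_def)
    have "e * B = a / 2" using B by (simp add: e_def)
    moreover have "e * - B \<le> e * b" using e by (intro mult_left_mono) (auto simp: B_def)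
    ultimately have aeb: "0 < a + e * b" using a by simp
    \<comment> \<open>Adding \<open>e\<close> gives the positive lower bound that \<open>g\<close>
      may lack, and dividing by \<open>m \<ge> e\<close> normalizes. On \<open>K\<close> the
      constraint survives because both \<open>g\<close> and the constant \<open>e\<close> yield
      non-positive expectations there.\<close>
    define m where "m = (LINT x|Q. g x + e)"
    define h where "h x = (g x + e) / m" for x
    have g1: "integrable Q g" using g_int[of "\<lambda>_. 1"] by simp
    have h_mult: "(LINT x|Q. h x * f x) = ((LINT x|Q. g x * f x) + e * (LINT x|Q. f x)) / m"
      if "integrable Q f" for f
      using that g_int[OF that] by (simp add: h_def distrib_right)
    have "e = (LINT x|Q. e)" by (simp add: Q.prob_space)
    also have "\<dots> \<le> m" unfolding m_def using g g1 by (intro integral_mono) auto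
    finally have m: "0 < m" using e by simp
    have D: "density P (\<lambda>x. ennreal (h x * density_rv P Q x)) \<in> M_Phi P K \<Phi>" (is "?D \<in> _")
    proof (rule density_bounded_in_M_Phi[OF P \<Phi> Q, of _ "e / m" "(1 + e) / m"])
      show "h \<in> borel_measurable P" unfolding h_def by measurable
      show "0 < e / m" using e m by simp
      show "e / m \<le> h x" "h x \<le> (1 + e) / m" for x
        using g(2,3)[of x] m by (auto simp: h_def divide_right_mono)
      show "(LINT x|Q. h x) = 1" using m by (simp add: h_def m_def)
      fix X assume X: "X \<in> K"
      show "(LINT x|Q. h x * X x) \<le> 0"
        using h_mult[OF M1_cone(2)[OF P M1 X]] M1_cone(3)[OF P M1 X] gS[OF K_S[OF X]] e m
        by (simp add: divide_nonpos_pos add_nonpos_nonpos mult_nonneg_nonpos)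
    qed
    have [measurable]: "density_rv P Q \<in> borel_measurable P" "h \<in> borel_measurable P"
      using M1_density_rv[OF P M1] unfolding h_def by measurable
    have "0 \<le> h x * density_rv P Q x" for x
      using g(2)[of x] e m by (simp add: h_def density_rv_nonneg)
    then have "(LINT x|?D. z x) = (LINT x|P. h x * density_rv P Q x * z x)"
      by (simp add: integral_real_density)
    also have "\<dots> = (LINT x|Q. h x * z x)"
      using M1_integral_eq(2)[OF P M1, of "\<lambda>x. h x * z x"] by (simp add: ac_simps)
    also have "\<dots> = (a + e * b) / m" by (simp add: h_mult[OF zi] a_def b_def)
    finally show False using le[OF D] aeb m by (simp add: divide_le_0_iff)
  qed
  then obtain f where f: "\<And>n. f n \<in> S" "\<And>n. (LINT x|Q. \<bar>z x - f n x\<bar>) < 1 / real (Suc n)"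
    by metis
  have "(\<lambda>n. LINT x|Q. \<bar>z x - f n x\<bar>) \<longlonglongrightarrow> 0"
    by (rule tendsto_sandwich[OF _ _ tendsto_const LIMSEQ_Suc[OF lim_1_over_n]])
      (use f(2) in \<open>auto intro!: always_eventually less_imp_le\<close>)
  then have "(\<lambda>n. ennreal (LINT x|Q. \<bar>z x - f n x\<bar>)) \<longlonglongrightarrow> ennreal 0"
    by (rule tendsto_ennrealI)
  moreover have "(\<integral>\<^sup>+x. ennreal \<bar>z x - f n x\<bar> \<partial>Q) = ennreal (LINT x|Q. \<bar>z x - f n x\<bar>)" for n
    using zi S_int[OF f(1)] by (intro nn_integral_eq_integral) auto
  ultimately have "(\<lambda>n. \<integral>\<^sup>+x. ennreal \<bar>z x - f n x\<bar> \<partial>Q) \<longlonglongrightarrow> 0" by simp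
  then show ?thesis
    unfolding L1_closure_def S_def[symmetric] using f(1) zi by (auto simp: L1_def intro!: exI[of _ f])
qed

theorem theorem6p3:
  fixes P :: "'a measure"
    and K :: "('a \<Rightarrow> real) set"
    and \<Phi> :: "real \<Rightarrow> ereal"
  assumes "prob_space P"
    and "L0_subset P K"
    and "convex_cone K"
    and "proper_convex_halfline \<Phi>"
    and "growth_condition \<Phi>"
    and "M_Phi P K \<Phi> \<noteq> {}"
  shows "C_Phi P K \<Phi> = polar P (E_Phi P K \<Phi>) (R_image P (M_Phi_hat P K \<Phi>)) \<and>
    polar P (E_Phi P K \<Phi>) (R_image P (M_Phi_hat P K \<Phi>)) =
      polar P (E_Phi P K \<Phi>) (R_image P (M_Phi P K \<Phi>)) \<and>
    closedin (weak_topology P (E_Phi P K \<Phi>) (F_Phi P K \<Phi>)) (C_Phi P K \<Phi>)"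
proof -
  let ?M = "M_Phi P K \<Phi>" and ?Mh = "M_Phi_hat P K \<Phi>" and ?E = "E_Phi P K \<Phi>"
  note P = assms(1)
  obtain Q0 where Q0: "Q0 \<in> ?M" using assms(6) by blast
  have M_hat: "?M \<subseteq> ?Mh"
  proof
    fix Q assume Q: "Q \<in> ?M"
    have "(\<integral>\<^sup>+x. e2ennreal (pos_part \<Phi> (density_rv P Q x)) * indicator {x. 1 \<le> density_rv P Q x} x \<partial>P)
        \<le> (\<integral>\<^sup>+x. e2ennreal (pos_part \<Phi> (density_rv P Q x)) \<partial>P)"
      by (intro nn_integral_mono) (auto split: split_indicator)
    with Q show "Q \<in> ?Mh" by (auto simp: M_Phi_def M_Phi_hat_def)
  qed
  have hat_M1: "?Mh \<subseteq> M1 P K" by (auto simp: M_Phi_hat_def)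
  \<comment> \<open>An intersection over an empty family would be the set of all functions; the
    measure \<open>Q0\<close> excludes this.\<close>
  have E: "?E \<subseteq> borel_measurable P" using Q0 by (auto simp: E_Phi_def L1_def)
  note polar_hat = polar_R_image[OF P hat_M1 E]
  note polar_M = polar_R_image[OF P order.trans[OF M_hat hat_M1] E]
  \<comment> \<open>One inclusion is antitonicity of the polar under \<open>M_hat\<close>; the other
    is the passage to the limit in the mixtures with \<open>Q0\<close>.\<close>
  have eq: "polar P ?E (R_image P ?Mh) = polar P ?E (R_image P ?M)"
    unfolding polar_hat polar_M
    using M_hat integral_M_Phi_hat_le[OF P assms(4,5) _ Q0] by blast
  have "C_Phi P K \<Phi> \<subseteq> polar P ?E (R_image P ?M)"
  proof
    fix z assume z: "z \<in> C_Phi P K \<Phi>"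
    then have "z \<in> L1_closure P Q {X - Y | X Y. X \<in> K \<and> Y \<in> L1_plus P Q}" if "Q \<in> ?M" for Q
      using that by (auto simp: C_Phi_def)
    moreover from this have "z \<in> ?E" by (auto simp: E_Phi_def L1_closure_def)
    ultimately show "z \<in> polar P ?E (R_image P ?M)"
      unfolding polar_M using integral_L1_closure_le[OF P] M_hat hat_M1 by blast
  qed
  moreover have "polar P ?E (R_image P ?M) \<subseteq> C_Phi P K \<Phi>"
    unfolding polar_M C_Phi_def using in_L1_closure[OF P assms(3-5)] by blast
  ultimately have C: "C_Phi P K \<Phi> = polar P ?E (R_image P ?M)" by blast
  have "closedin (weak_topology P ?E (F_Phi P K \<Phi>)) (polar P ?E (R_image P ?M))"
    unfolding F_Phi_def by (rule closedin_weak_polar) (use span_zero span_superset in blast)+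
  with C eq show ?thesis by simp
qed

end
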